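(* Let $m,n,\ell$ be positive integers with $m\ge 2$, let $\Omega:\mathbb{R}^n\rightrightarrows\mathbb{R}^\ell$ be a set-valued mapping with closed values, for each $\omega\in\mathbb{R}^\ell$ let $\mathcal{B}(\omega)$ be a real tensor of order $m$ and dimension $n$, and let $p:\mathbb{R}^\ell\to\mathbb{R}^n$. For the set-valued tensor complementarity problem SVTCP$(\mathcal{B}(\omega),p(\omega),\Omega)$, the following statements hold. (a) If the set of tensors $\{\mathcal{B}(\omega):\omega\in\Omega(v)\}$ is strongly semi-positive, then for any positive mapping $p$, i.e. $p(\omega)>0$ for all $\omega$, SVTCP$(\mathcal{B}(\omega),p(\omega),\Omega)$ has zero as its unique solution. (b) If SVTCP$(\mathcal{B}(\omega),p(\omega),\Omega)$ with $p(\omega)>0$ has zero as its unique solution, then the set of tensors $\{\mathcal{B}(\omega):\omega\in\Omega(v)\}$ is weakly semi-positive.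
   Context: A real tensor of order $m$ and dimension $n$ is an array $\mathcal{B}=(b_{i_1\ldots i_m})$ of real numbers with $i_j\in\{1,\ldots,n\}$. For $v\in\mathbb{R}^n$, $\mathcal{B}v^{m-1}\in\mathbb{R}^n$ is the vector with components $(\mathcal{B}v^{m-1})_i=\sum_{i_2,\ldots,i_m=1}^n b_{i i_2\ldots i_m}v_{i_2}\cdots v_{i_m}$. Vector inequalities are componentwise. A set-valued mapping $\Omega:\mathbb{R}^n\rightrightarrows\mathbb{R}^\ell$ assigns to each $v\in\mathbb{R}^n$ a subset $\Omega(v)\subseteq\mathbb{R}^\ell$. The problem SVTCP$(\mathcal{B}(\omega),p(\omega),\Omega)$ is to find a vector $v\in\mathbb{R}^n$ such that $v\ge 0$, $\mathcal{B}(\omega)v^{m-1}+p(\omega)\ge 0$ and $v^T(\mathcal{B}(\omega)v^{m-1}+p(\omega))=0$ for some $\omega\in\Omega(v)$; such a $v$ is called a solution. The set of tensors $\{\mathcal{B}(\omega):\omega\in\Omega(v)\}$ is strongly semi-positive if for any nonzero $v\ge 0$ in $\mathbb{R}^n$ there is an index $k$ with $v_k>0$ such that $(\mathcal{B}(\omega)v^{m-1})_k\ge 0$ for all $\omega\in\Omega(v)$. It is weakly semi-positive if for any nonzero $v\ge 0$ in $\mathbb{R}^n$ there is an index $k$ with $v_k>0$ such that $(\mathcal{B}(\omega)v^{m-1})_k\ge 0$ for some $\omega\in\Omega(v)$.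
   Formalization: Part (a) assumes Ω(0) is nonempty and part (b) assumes Ω(v) is nonempty for every nonzero v ≥ 0 (both fail otherwise); in (b), zero is assumed to be the unique solution for every positive mapping p, since for one fixed p the claim is false. *)

theory Defs
  imports "HOL-Analysis.Analysis"
begin

(* A tensor of order m and dimension CARD('n) is given by its entries
   b_{i_1 ... i_m} = b [i_1, ..., i_m]; values at lists of length other than m are irrelevant. *)
type_synonym 'n tensor = "'n list \<Rightarrow> real"

definition tensor_vec :: "nat \<Rightarrow> 'n::finite tensor \<Rightarrow> real ^ 'n \<Rightarrow> real ^ 'n" where
  "tensor_vec m b v = (\<chi> i. \<Sum>js | length js = m - 1. b (i # js) * (\<Prod>j\<leftarrow>js. v $ j))"

(* Spelled out because the library's < on vectors is the strict part of \<le>,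
   not componentwise strict inequality. *)
definition positive_mapping :: "('w \<Rightarrow> real ^ 'n::finite) \<Rightarrow> bool" where
  "positive_mapping p \<longleftrightarrow> (\<forall>\<omega> k. 0 < p \<omega> $ k)"

definition svtcp_solution ::
  "nat \<Rightarrow> ('w \<Rightarrow> 'n::finite tensor) \<Rightarrow> ('w \<Rightarrow> real ^ 'n) \<Rightarrow> (real ^ 'n \<Rightarrow> 'w set) \<Rightarrow> real ^ 'n \<Rightarrow> bool"
  where
  "svtcp_solution m B p \<Omega> v \<longleftrightarrow>
     (\<exists>\<omega>\<in>\<Omega> v. 0 \<le> v \<and> 0 \<le> tensor_vec m (B \<omega>) v + p \<omega> \<and>
               v \<bullet> (tensor_vec m (B \<omega>) v + p \<omega>) = 0)"

definition strongly_semi_positive ::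
  "nat \<Rightarrow> ('w \<Rightarrow> 'n::finite tensor) \<Rightarrow> (real ^ 'n \<Rightarrow> 'w set) \<Rightarrow> bool" where
  "strongly_semi_positive m B \<Omega> \<longleftrightarrow>
     (\<forall>v. 0 \<le> v \<and> v \<noteq> 0 \<longrightarrow>
        (\<exists>k. 0 < v $ k \<and> (\<forall>\<omega>\<in>\<Omega> v. 0 \<le> tensor_vec m (B \<omega>) v $ k)))"

definition weakly_semi_positive ::
  "nat \<Rightarrow> ('w \<Rightarrow> 'n::finite tensor) \<Rightarrow> (real ^ 'n \<Rightarrow> 'w set) \<Rightarrow> bool" where
  "weakly_semi_positive m B \<Omega> \<longleftrightarrow>
     (\<forall>v. 0 \<le> v \<and> v \<noteq> 0 \<longrightarrow>
        (\<exists>k. 0 < v $ k \<and> (\<exists>\<omega>\<in>\<Omega> v. 0 \<le> tensor_vec m (B \<omega>) v $ k)))"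

end

theory Submission
  imports Defs
begin

text \<open>Since \<open>m\<close> is at least 2, every \<open>js\<close> is nonempty and its
  product contains a zero factor. For \<open>m = 1\<close> the empty product 1 would leave the
  constant \<open>b [i]\<close>.\<close>

lemma tensor_vec_zero:
  assumes "2 \<le> m"
  shows "tensor_vec m b 0 = 0"
proof -
  have "(\<Prod>j\<leftarrow>js. (0 :: real ^ 'a) $ j) = 0" if "length js = m - 1" for js :: "'a list"
    using that assms by (cases js) auto
  then show ?thesis
    by (simp add: tensor_vec_def vec_eq_iff)
qed

lemma svtcp_solution_zero:
  assumes "2 \<le> m" and "\<Omega> 0 \<noteq> {}" and "positive_mapping p"
  shows "svtcp_solution m B p \<Omega> 0"
  using assms
  by (auto simp: svtcp_solution_def tensor_vec_zero positive_mapping_def less_eq_vec_def less_imp_le)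

text \<open>All terms of the vanishing inner product are nonnegative, so one positive term is a
  contradiction. Strong semi-positivity covers all of \<open>\<Omega> v\<close>, hence also the
  \<open>\<omega>\<close> that witnesses the solution, and \<open>p\<close> makes the term at
  \<open>k\<close> strictly positive.\<close>

lemma strongly_semi_positive_solution_eq_zero:
  assumes ssp: "strongly_semi_positive m B \<Omega>" and pos: "positive_mapping p"
    and sol: "svtcp_solution m B p \<Omega> v"
  shows "v = 0"
proof (rule ccontr)
  assume "v \<noteq> 0"
  obtain \<omega> where \<omega>: "\<omega> \<in> \<Omega> v" and v: "0 \<le> v"
    and w: "0 \<le> tensor_vec m (B \<omega>) v + p \<omega>"
    and compl: "v \<bullet> (tensor_vec m (B \<omega>) v + p \<omega>) = 0"
    using sol by (auto simp: svtcp_solution_def)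
  obtain k where k: "0 < v $ k" and "0 \<le> tensor_vec m (B \<omega>) v $ k"
    using ssp v \<open>v \<noteq> 0\<close> \<omega> unfolding strongly_semi_positive_def by blast
  then have "0 < (tensor_vec m (B \<omega>) v + p \<omega>) $ k"
    using pos by (simp add: positive_mapping_def add_nonneg_pos)
  with k have "0 < v $ k * (tensor_vec m (B \<omega>) v + p \<omega>) $ k"
    by (rule mult_pos_pos)
  also have "\<dots> \<le> (\<Sum>i\<in>UNIV. v $ i * (tensor_vec m (B \<omega>) v + p \<omega>) $ i)"
    using v w by (intro member_le_sum) (auto simp: less_eq_vec_def intro!: mult_nonneg_nonneg)
  also have "\<dots> = 0"
    using compl by (simp add: inner_vec_def)
  finally show False by simp
qed

text \<open>If weak semi-positivity fails at \<open>v\<close>, then \<open>tensor_vec m (B \<omega>) v\<close> is negative on the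
  support of \<open>v\<close> for every \<open>\<omega> \<in> \<Omega> v\<close>; a positive \<open>p\<close> cancelling it there and dominating
  it elsewhere makes \<open>v\<close> a second solution.\<close>

lemma positive_mapping_nonzero_solution:
  fixes B :: "'w \<Rightarrow> 'n::finite tensor"
  assumes v: "0 \<le> v" and \<omega>: "\<omega> \<in> \<Omega> v"
    and neg: "\<And>k. 0 < v $ k \<Longrightarrow> tensor_vec m (B \<omega>) v $ k < 0"
  obtains p where "positive_mapping p" and "svtcp_solution m B p \<Omega> v"
proof
  \<comment> \<open>\<open>neg\<close> speaks only of the fixed \<open>\<omega>\<close>, whereas
    \<open>p\<close> must be positive at every parameter; hence the extra test \<open>t < 0\<close>.
    The sum \<open>t + p\<close> is 0 in the first branch and at least 1 in the second.\<close>
  define p where "p \<omega> = (\<chi> k. let t = tensor_vec m (B \<omega>) v $ k in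
      if 0 < v $ k \<and> t < 0 then - t else \<bar>t\<bar> + 1)" for \<omega>
  show "positive_mapping p"
    by (simp add: positive_mapping_def p_def Let_def add_nonneg_pos)
  have "v $ k * (tensor_vec m (B \<omega>) v + p \<omega>) $ k = 0" for k
  proof (cases "0 < v $ k")
    case True
    then show ?thesis using neg by (simp add: p_def)
  next
    case False
    moreover have "0 \<le> v $ k" using v by (simp add: less_eq_vec_def)
    ultimately show ?thesis by simp
  qed
  then have "v \<bullet> (tensor_vec m (B \<omega>) v + p \<omega>) = 0"
    unfolding inner_vec_def inner_real_def by (intro sum.neutral) blast
  moreover have "0 \<le> tensor_vec m (B \<omega>) v + p \<omega>"
    by (auto simp: less_eq_vec_def p_def Let_def)
  ultimately show "svtcp_solution m B p \<Omega> v"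
    using v \<omega> by (auto simp: svtcp_solution_def)
qed

text \<open>The refuting \<open>p\<close> is built from the point where weak semi-positivity fails,
  so \<open>uniq\<close> ranges over all positive \<open>p\<close>. If \<open>\<Omega> v\<close>
  were empty at a nonzero \<open>v \<ge> 0\<close>, weak semi-positivity would fail there although
  \<open>v\<close> solves no instance; \<open>ne\<close> excludes this.\<close>

lemma weakly_semi_positive_if_solutions_zero:
  fixes B :: "'w \<Rightarrow> 'n::finite tensor"
  assumes ne: "\<And>v. 0 \<le> v \<Longrightarrow> v \<noteq> 0 \<Longrightarrow> \<Omega> v \<noteq> {}"
    and uniq: "\<And>p v. positive_mapping p \<Longrightarrow> svtcp_solution m B p \<Omega> v \<Longrightarrow> v = 0"
  shows "weakly_semi_positive m B \<Omega>"
proof (rule ccontr)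
  assume "\<not> weakly_semi_positive m B \<Omega>"
  then obtain v where v: "0 \<le> v" "v \<noteq> 0"
    and neg: "\<And>k \<omega>. 0 < v $ k \<Longrightarrow> \<omega> \<in> \<Omega> v \<Longrightarrow> tensor_vec m (B \<omega>) v $ k < 0"
    unfolding weakly_semi_positive_def by (force simp: not_le)
  obtain \<omega> where \<omega>: "\<omega> \<in> \<Omega> v" using ne v by blast
  obtain p where "positive_mapping p" and "svtcp_solution m B p \<Omega> v"
    using v(1) \<omega> neg[OF _ \<omega>] by (rule positive_mapping_nonzero_solution)
  with uniq v(2) show False by blast
qed

text \<open>In the second half a single \<open>p\<close> would not suffice: in dimension one with
  \<open>m = 2\<close>, \<open>\<Omega> v = {v}\<close>, constant entry -1 and
  \<open>p \<omega> = 1 + \<bar>\<omega>\<bar>\<close>, zero is the unique solution, yet weak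
  semi-positivity fails.\<close>

theorem theorem3p3:
  fixes m :: nat
    and B :: "real ^ 'l::finite \<Rightarrow> 'n::finite tensor"
    and \<Omega> :: "real ^ 'n \<Rightarrow> (real ^ 'l) set"
  assumes "2 \<le> m"
    and "\<And>v. closed (\<Omega> v)"
  shows "(\<Omega> 0 \<noteq> {} \<longrightarrow> strongly_semi_positive m B \<Omega> \<longrightarrow>
            (\<forall>p. positive_mapping p \<longrightarrow> {v. svtcp_solution m B p \<Omega> v} = {0})) \<and>
         ((\<forall>v. 0 \<le> v \<and> v \<noteq> 0 \<longrightarrow> \<Omega> v \<noteq> {}) \<longrightarrow>
            (\<forall>p. positive_mapping p \<longrightarrow> {v. svtcp_solution m B p \<Omega> v} = {0}) \<longrightarrow>
            weakly_semi_positive m B \<Omega>)"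
proof (intro conjI impI allI)
  fix p :: "real ^ 'l \<Rightarrow> real ^ 'n"
  assume ne: "\<Omega> 0 \<noteq> {}" and ssp: "strongly_semi_positive m B \<Omega>"
    and pos: "positive_mapping p"
  show "{v. svtcp_solution m B p \<Omega> v} = {0}"
    \<comment> \<open>The set equality needs both inclusions: zero is a solution, with any element
      of \<open>\<Omega> 0\<close> as witness because the residual there is \<open>p\<close> itself,
      and every solution is zero.\<close>
    using svtcp_solution_zero[of m \<Omega> p B, OF assms(1) ne pos]
      strongly_semi_positive_solution_eq_zero[OF ssp pos] by blast
next
  assume "\<forall>v. 0 \<le> v \<and> v \<noteq> 0 \<longrightarrow> \<Omega> v \<noteq> {}"
    and "\<forall>p. positive_mapping p \<longrightarrow> {v. svtcp_solution m B p \<Omega> v} = {0}"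
  then show "weakly_semi_positive m B \<Omega>"
    by (intro weakly_semi_positive_if_solutions_zero) blast+
qed

end
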